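(* Let $s\in\{1,\dots,n\}$, let $h^s:\mathbb{R}^{m\times s}\to\mathbb{R}^q$, $h^s(H)=h([H\ \ 0^{m\times(n-s)}])$, and let $\mathcal{H}^s=\{H\in\mathbb{R}^{m\times s}:h^s(H)=0\}$. If $\mathcal{H}^s$ is nonempty, then it is an embedded submanifold in $\mathbb{R}^{m\times s}$ of dimension $ms-q$.
   Context: The map $h:\mathbb{R}^{m\times n}\to\mathbb{R}^q$ is smooth and orthogonally invariant, i.e. $h(XQ)=h(X)$ for all $X\in\mathbb{R}^{m\times n}$ and all $Q\in\mathcal{O}(n)=\{Q\in\mathbb{R}^{n\times n}:Q^\top Q=I_n\}$. Put $\mathcal{H}=\{X\in\mathbb{R}^{m\times n}:h(X)=0\}$; it is assumed that the differential $\mathrm{D}h_X$ has rank $q$ for all $X\in\mathcal{H}$. *)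

theory Defs
  imports "HOL-Analysis.Analysis"
begin

(* C^k maps. The definition is meant for open S, where frechet_derivative at a point
   of S is the total derivative of f. In finite dimension, requiring every directional
   derivative to be C^k is the same as requiring the derivative to be C^k as a map
   into the space of linear maps. *)
fun times_cont_diff_on ::
    "nat \<Rightarrow> ('a::euclidean_space \<Rightarrow> 'b::euclidean_space) \<Rightarrow> 'a set \<Rightarrow> bool" where
  "times_cont_diff_on 0 f S \<longleftrightarrow> continuous_on S f"
| "times_cont_diff_on (Suc k) f S \<longleftrightarrow>
     (\<forall>x\<in>S. f differentiable (at x)) \<and>
     (\<forall>v. times_cont_diff_on k (\<lambda>x. frechet_derivative f (at x) v) S)"

definition smooth_on :: "('a::euclidean_space \<Rightarrow> 'b::euclidean_space) \<Rightarrow> 'a set \<Rightarrow> bool" where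
  "smooth_on f S \<longleftrightarrow> (\<forall>k. times_cont_diff_on k f S)"

definition diffeomorphism ::
    "'a::euclidean_space set \<Rightarrow> 'b::euclidean_space set \<Rightarrow> ('a \<Rightarrow> 'b) \<Rightarrow> ('b \<Rightarrow> 'a) \<Rightarrow> bool" where
  "diffeomorphism U V \<phi> \<psi> \<longleftrightarrow>
     open U \<and> open V \<and> homeomorphism U V \<phi> \<psi> \<and> smooth_on \<phi> U \<and> smooth_on \<psi> V"

(* Local slice condition: around each of its points, M is straightened by an ambient
   diffeomorphism onto an open piece of a d-dimensional linear subspace. The subspace L
   stands for R^d x {0}, to which it can be moved by a linear isomorphism. *)
definition embedded_submanifold :: "nat \<Rightarrow> 'a::euclidean_space set \<Rightarrow> bool" where
  "embedded_submanifold d M \<longleftrightarrow>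
     (\<forall>x\<in>M. \<exists>U V \<phi> \<psi>. \<exists>L::'a set.
        x \<in> U \<and> diffeomorphism U V \<phi> \<psi> \<and>
        subspace L \<and> dim L = d \<and> \<phi> ` (M \<inter> U) = L \<inter> V)"

definition orthogonally_invariant :: "(real^'n^'m \<Rightarrow> 'b) \<Rightarrow> bool" where
  "orthogonally_invariant h \<longleftrightarrow> (\<forall>X Q. orthogonal_matrix Q \<longrightarrow> h (X ** Q) = h X)"

(* The zero-based position of an index, so that column j of a matrix is its
   (col_pos j + 1)-st column. On a finite linear order with n elements this is the
   order isomorphism onto {0..<n}. *)
definition col_pos :: "'n::{finite,linorder} \<Rightarrow> nat" where
  "col_pos j = card {k. k < j}"

(* The block matrix [H 0]; meaningful when CARD('s) \<le> CARD('n). *)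
definition append_zero_cols ::
    "real^'s::{finite,linorder}^'m \<Rightarrow> real^'n::{finite,linorder}^'m" where
  "append_zero_cols H =
     (\<chi> i j. if col_pos j < CARD('s) then H $ i $ (THE k. col_pos k = col_pos j) else 0)"

definition restrict_cols ::
    "(real^'n::{finite,linorder}^'m \<Rightarrow> 'b) \<Rightarrow> real^'s::{finite,linorder}^'m \<Rightarrow> 'b" where
  "restrict_cols h H = h (append_zero_cols H)"

end

theory Submission
  imports Defs
begin

text \<open>
  Zero is a regular value of \<open>restrict_cols h\<close>, so its zero set is a submanifold by the regular
  value theorem. Two things have to be supplied.

  Regularity is where orthogonal invariance enters. Let \<open>Q\<close> be the orthogonal matrix
  \<open>diag(1, ..., 1, -1, ..., -1)\<close> with \<open>s\<close> entries \<open>1\<close>. It fixes every \<open>X = [H 0]\<close>, so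
  differentiating \<open>h (X Q) = h X\<close> at such a point in the direction \<open>[E F]\<close> gives
  \<open>Dh_X [E -F] = Dh_X [E F]\<close>, that is, \<open>Dh_X [0 F] = 0\<close>. The columns that were set to zero
  therefore contribute nothing to the range of \<open>Dh_X\<close>, and the derivative of the restricted map has
  the same range (\<open>range_derivative_restrict_cols\<close>). At a zero this range is all of the target,
  which also forces \<open>q \<le> m s\<close>.

  The regular value theorem (\<open>embedded_submanifold_regular_level_set\<close>) follows from the inverse
  function theorem. At a zero \<open>x\<close> of \<open>h\<close>, let \<open>D\<close> be the surjective derivative, \<open>R\<close> a linear
  right inverse of \<open>D\<close>, and \<open>P = id - R D\<close> the projection onto \<open>ker D\<close> along the range of \<open>R\<close>.
  The map \<open>\<phi> y = P y + R (h y)\<close> has derivative \<open>P + R D = id\<close> at \<open>x\<close>, and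
  \<open>D (\<phi> y) = h y\<close>. So it is a local diffeomorphism that carries the zero set of \<open>h\<close> to the
  subspace \<open>ker D\<close>. The inverse function theorem for C^1 maps yields a differentiable local
  inverse \<open>g\<close>. For its smoothness, note that \<open>D g_y\<close> is the inverse of \<open>D f_(g y)\<close>: if \<open>g\<close> is C^k,
  so is the field of linear maps \<open>D f_(g y)\<close>, hence so is the field of their inverses
  (\<open>times_cont_diff_on_linear_inverse\<close>), and thus \<open>g\<close> is C^(k+1).
\<close>

section \<open>Calculus of C^k maps\<close>

lemma times_cont_diff_on_cong:
  assumes "open S" "\<And>x. x \<in> S \<Longrightarrow> f x = g x" "times_cont_diff_on k f S"
  shows "times_cont_diff_on k g S"
  using assms(2,3)
proof (induction k arbitrary: f g)
  case 0
  then show ?case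
    by (metis continuous_on_eq times_cont_diff_on.simps(1))
next
  case (Suc k)
  have der: "(g has_derivative frechet_derivative f (at x)) (at x)" if "x \<in> S" for x
  proof (rule has_derivative_transform_within_open[OF _ \<open>open S\<close> that])
    show "(f has_derivative frechet_derivative f (at x)) (at x)"
      using Suc.prems(2) that by (simp add: frechet_derivative_works[symmetric])
  qed (use Suc.prems(1) in auto)
  then have eq: "frechet_derivative f (at x) = frechet_derivative g (at x)" if "x \<in> S" for x
    using frechet_derivative_at that by blast
  have "times_cont_diff_on k (\<lambda>x. frechet_derivative g (at x) v) S" for v
    using Suc.IH[of "\<lambda>x. frechet_derivative f (at x) v" "\<lambda>x. frechet_derivative g (at x) v"]
      eq Suc.prems(2) by simp
  then show ?case
    using der by (auto simp: differentiable_def)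
qed

lemma times_cont_diff_on_SucI:
  assumes "open S" "\<And>x. x \<in> S \<Longrightarrow> (f has_derivative f' x) (at x)"
    and "\<And>v. times_cont_diff_on k (\<lambda>x. f' x v) S"
  shows "times_cont_diff_on (Suc k) f S"
proof -
  have "f' x = frechet_derivative f (at x)" if "x \<in> S" for x
    using assms(2)[OF that] frechet_derivative_at by blast
  then have "times_cont_diff_on k (\<lambda>x. frechet_derivative f (at x) v) S" for v
    using times_cont_diff_on_cong[OF assms(1) _ assms(3)[of v]] by simp
  then show ?thesis
    using assms(2) by (auto simp: differentiable_def)
qed

lemma times_cont_diff_on_SucD:
  assumes "times_cont_diff_on (Suc k) f S"
  shows "x \<in> S \<Longrightarrow> (f has_derivative frechet_derivative f (at x)) (at x)"
    and "times_cont_diff_on k (\<lambda>x. frechet_derivative f (at x) v) S"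
  using assms by (simp_all add: frechet_derivative_works[symmetric])

lemma times_cont_diff_on_Suc_imp:
  "times_cont_diff_on (Suc k) f S \<Longrightarrow> times_cont_diff_on k f S"
proof (induction k arbitrary: f)
  case 0
  then show ?case
    by (auto intro!: continuous_at_imp_continuous_on differentiable_imp_continuous_within)
next
  case (Suc k)
  have "times_cont_diff_on k (\<lambda>x. frechet_derivative f (at x) v) S" for v
    using Suc.IH times_cont_diff_on_SucD(2)[OF Suc.prems] by blast
  then show ?case
    using Suc.prems by auto
qed

lemma times_cont_diff_on_imp_continuous_on:
  "times_cont_diff_on k f S \<Longrightarrow> continuous_on S f"
proof (induction k)
  case (Suc k)
  then show ?case
    using times_cont_diff_on_Suc_imp by blast
qed simp

lemma times_cont_diff_on_subset:
  "times_cont_diff_on k f S \<Longrightarrow> T \<subseteq> S \<Longrightarrow> times_cont_diff_on k f T"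
  by (induction k arbitrary: f) (auto intro: continuous_on_subset)

lemma times_cont_diff_on_const:
  assumes "open S"
  shows "times_cont_diff_on k (\<lambda>x. c) S"
proof (induction k arbitrary: c)
  case (Suc k)
  show ?case
    by (rule times_cont_diff_on_SucI[OF assms, where f' = "\<lambda>x v. 0"]) (use Suc in auto)
qed simp

lemma times_cont_diff_on_linear:
  assumes "open S" "bounded_linear L"
  shows "times_cont_diff_on k L S"
proof (cases k)
  case 0
  then show ?thesis
    using assms by (simp add: linear_continuous_on)
next
  case (Suc j)
  show ?thesis
    unfolding Suc
    by (rule times_cont_diff_on_SucI[OF assms(1), where f' = "\<lambda>x. L"])
      (use assms in \<open>auto intro: bounded_linear_imp_has_derivative times_cont_diff_on_const\<close>)
qed

lemma times_cont_diff_on_linear_compose: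
  assumes "open S" "bounded_linear L" "times_cont_diff_on k f S"
  shows "times_cont_diff_on k (\<lambda>x. L (f x)) S"
  using assms(3)
proof (induction k arbitrary: f)
  case 0
  then show ?case
    using assms(2) by (simp add: bounded_linear.continuous_on)
next
  case (Suc k)
  show ?case
  proof (rule times_cont_diff_on_SucI[OF assms(1)])
    show "((\<lambda>x. L (f x)) has_derivative (\<lambda>v. L (frechet_derivative f (at x) v))) (at x)"
      if "x \<in> S" for x
      using times_cont_diff_on_SucD(1)[OF Suc.prems that] assms(2)
      by (rule bounded_linear.has_derivative[rotated])
    show "times_cont_diff_on k (\<lambda>x. L (frechet_derivative f (at x) v)) S" for v
      using Suc.IH times_cont_diff_on_SucD(2)[OF Suc.prems] by blast
  qed
qed

lemma times_cont_diff_on_add: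
  assumes "open S" "times_cont_diff_on k f S" "times_cont_diff_on k g S"
  shows "times_cont_diff_on k (\<lambda>x. f x + g x) S"
  using assms(2,3)
proof (induction k arbitrary: f g)
  case 0
  then show ?case
    by (simp add: continuous_on_add)
next
  case (Suc k)
  show ?case
  proof (rule times_cont_diff_on_SucI[OF assms(1)])
    show "((\<lambda>x. f x + g x) has_derivative
        (\<lambda>v. frechet_derivative f (at x) v + frechet_derivative g (at x) v)) (at x)"
      if "x \<in> S" for x
      using Suc.prems[THEN times_cont_diff_on_SucD(1), OF that] by (rule has_derivative_add)
    show "times_cont_diff_on k
        (\<lambda>x. frechet_derivative f (at x) v + frechet_derivative g (at x) v) S" for v
      using Suc.IH Suc.prems[THEN times_cont_diff_on_SucD(2)] by blast
  qed
qed

lemma times_cont_diff_on_sum: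
  assumes "open S" "finite I" "\<And>i. i \<in> I \<Longrightarrow> times_cont_diff_on k (f i) S"
  shows "times_cont_diff_on k (\<lambda>x. \<Sum>i\<in>I. f i x) S"
  using assms(2,3)
  by (induction I)
    (auto intro: times_cont_diff_on_add[OF assms(1)] times_cont_diff_on_const[OF assms(1)])

lemma times_cont_diff_on_bilinear:
  assumes "open S" "bounded_bilinear B" "times_cont_diff_on k f S" "times_cont_diff_on k g S"
  shows "times_cont_diff_on k (\<lambda>x. B (f x) (g x)) S"
  using assms(3,4)
proof (induction k arbitrary: f g)
  case 0
  then show ?case
    by (simp add: bounded_bilinear.continuous_on[OF assms(2)])
next
  case (Suc k)
  show ?case
  proof (rule times_cont_diff_on_SucI[OF assms(1)])
    show "((\<lambda>x. B (f x) (g x)) has_derivative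
        (\<lambda>v. B (f x) (frechet_derivative g (at x) v) + B (frechet_derivative f (at x) v) (g x)))
        (at x)"
      if "x \<in> S" for x
      using Suc.prems[THEN times_cont_diff_on_SucD(1), OF that]
      by (rule bounded_bilinear.FDERIV[OF assms(2)])
    show "times_cont_diff_on k
        (\<lambda>x. B (f x) (frechet_derivative g (at x) v) + B (frechet_derivative f (at x) v) (g x)) S"
      for v
      by (intro times_cont_diff_on_add assms(1) Suc.IH Suc.prems[THEN times_cont_diff_on_Suc_imp]
          Suc.prems[THEN times_cont_diff_on_SucD(2)])
  qed
qed

lemma times_cont_diff_on_inner_left:
  assumes "open S" "times_cont_diff_on k f S"
  shows "times_cont_diff_on k (\<lambda>x. f x \<bullet> b) S"
  using times_cont_diff_on_linear_compose[OF assms(1) bounded_linear_inner_left assms(2)] .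

lemma linear_eq_sum_Basis:
  fixes A :: "'a::euclidean_space \<Rightarrow> 'b::real_vector"
  assumes "linear A"
  shows "A v = (\<Sum>i\<in>Basis. (v \<bullet> i) *\<^sub>R A i)"
proof -
  have "A v = A (\<Sum>i\<in>Basis. (v \<bullet> i) *\<^sub>R i)"
    by (simp add: euclidean_representation)
  then show ?thesis
    using assms by (simp add: linear_sum linear_scale)
qed

text \<open>
  The chain rule is expanded in a basis, because the claim for \<open>k\<close> covers only derivatives in
  a constant direction, whereas the direction \<open>D g_x v\<close> varies with \<open>x\<close>.
\<close>

lemma times_cont_diff_on_compose:
  fixes f :: "'b::euclidean_space \<Rightarrow> 'c::euclidean_space" and g :: "'a::euclidean_space \<Rightarrow> 'b"
  assumes "open S" "g ` S \<subseteq> T" "times_cont_diff_on k f T" "times_cont_diff_on k g S"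
  shows "times_cont_diff_on k (\<lambda>x. f (g x)) S"
  using assms(3,4)
proof (induction k arbitrary: f)
  case 0
  then show ?case
    using assms(2) continuous_on_compose2 by (metis times_cont_diff_on.simps(1))
next
  case (Suc k)
  show ?case
  proof (rule times_cont_diff_on_SucI[OF assms(1)])
    show "((\<lambda>x. f (g x)) has_derivative
        (\<lambda>v. \<Sum>i\<in>Basis. (frechet_derivative g (at x) v \<bullet> i) *\<^sub>R
            frechet_derivative f (at (g x)) i)) (at x)"
      if "x \<in> S" for x
    proof -
      have df: "(f has_derivative frechet_derivative f (at (g x))) (at (g x))"
        using times_cont_diff_on_SucD(1)[OF Suc.prems(1)] assms(2) that by blast
      then have "linear (frechet_derivative f (at (g x)))"
        using has_derivative_linear by blast
      note lin = linear_eq_sum_Basis[OF this]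
      have "((\<lambda>x. f (g x)) has_derivative
          (\<lambda>v. frechet_derivative f (at (g x)) (frechet_derivative g (at x) v))) (at x)"
        using has_derivative_compose[OF times_cont_diff_on_SucD(1)[OF Suc.prems(2) that] df] .
      also have "(\<lambda>v. frechet_derivative f (at (g x)) (frechet_derivative g (at x) v)) =
          (\<lambda>v. \<Sum>i\<in>Basis. (frechet_derivative g (at x) v \<bullet> i) *\<^sub>R
              frechet_derivative f (at (g x)) i)"
        by (rule ext) (rule lin)
      finally show ?thesis .
    qed
    have "times_cont_diff_on k (\<lambda>x. frechet_derivative f (at (g x)) i) S" for i
      using times_cont_diff_on_SucD(2)[OF Suc.prems(1)] times_cont_diff_on_Suc_imp[OF Suc.prems(2)]
      by (rule Suc.IH)
    then show "times_cont_diff_on k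
        (\<lambda>x. \<Sum>i\<in>Basis. (frechet_derivative g (at x) v \<bullet> i) *\<^sub>R
            frechet_derivative f (at (g x)) i) S" for v
      by (intro times_cont_diff_on_sum times_cont_diff_on_bilinear[OF _ bounded_bilinear_scaleR]
          times_cont_diff_on_inner_left times_cont_diff_on_SucD(2)[OF Suc.prems(2)]
          assms(1) finite_Basis)
  qed
qed

section \<open>Smoothness of inverses\<close>

text \<open>
  The product rule with a factor that is only continuous. The other factor vanishes at the point, so
  the increment of \<open>c\<close> is multiplied by a term of first order and does not contribute.
\<close>

lemma has_derivative_scaleR_vanishing:
  fixes s :: "'a::real_normed_vector \<Rightarrow> real" and c :: "'a \<Rightarrow> 'b::real_normed_vector"
  assumes "(s has_derivative s') (at x)" "s x = 0" "isCont c x"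
  shows "((\<lambda>y. s y *\<^sub>R c y) has_derivative (\<lambda>v. s' v *\<^sub>R c x)) (at x)"
proof -
  obtain K where K: "\<And>v. norm (s' v) \<le> norm v * K"
    using bounded_linear.bounded has_derivative_bounded_linear[OF assms(1)] by blast
  have quot: "((\<lambda>y. (s y - s x - s' (y - x)) /\<^sub>R norm (y - x)) \<longlongrightarrow> 0) (at x)"
    using assms(1) by (simp add: has_derivative_at_within)
  have quot_split: "((a - b) /\<^sub>R n) *\<^sub>R u + (b / n) *\<^sub>R (u - w) = (a *\<^sub>R u - b *\<^sub>R w) /\<^sub>R n"
    for a b n :: real and u w :: 'b
    by (simp add: divide_inverse scaleR_diff_left scaleR_diff_right right_diff_distrib mult.commute)
  have "((\<lambda>y. ((s y - s x - s' (y - x)) /\<^sub>R norm (y - x)) *\<^sub>R c y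
      + (s' (y - x) / norm (y - x)) *\<^sub>R (c y - c x)) \<longlongrightarrow> 0 *\<^sub>R c x + 0) (at x)"
  proof (intro tendsto_add tendsto_scaleR quot)
    show c: "(c \<longlongrightarrow> c x) (at x)"
      using assms(3) by (simp add: isCont_def)
    show "((\<lambda>y. (s' (y - x) / norm (y - x)) *\<^sub>R (c y - c x)) \<longlongrightarrow> 0) (at x)"
    proof (rule Lim_null_comparison)
      show "\<forall>\<^sub>F y in at x. norm ((s' (y - x) / norm (y - x)) *\<^sub>R (c y - c x))
          \<le> K * norm (c y - c x)"
      proof -
        have "norm ((s' (y - x) / norm (y - x)) *\<^sub>R (c y - c x)) \<le> K * norm (c y - c x)"
          if "y \<noteq> x" for y
        proof -
          have "\<bar>s' (y - x) / norm (y - x)\<bar> \<le> K"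
            using K[of "y - x"] that by (simp add: field_simps)
          then show ?thesis
            unfolding norm_scaleR by (intro mult_right_mono) simp_all
        qed
        then show ?thesis
          by (simp add: eventually_at_filter)
      qed
      show "((\<lambda>y. K * norm (c y - c x)) \<longlongrightarrow> 0) (at x)"
        using c by (intro tendsto_mult_right_zero tendsto_norm_zero LIM_zero)
    qed
  qed
  then have "((\<lambda>y. (s y *\<^sub>R c y - s x *\<^sub>R c x - s' (y - x) *\<^sub>R c x) /\<^sub>R norm (y - x)) \<longlongrightarrow> 0) (at x)"
    unfolding quot_split by (simp add: assms(2))
  moreover have "bounded_linear (\<lambda>v. s' v *\<^sub>R c x)"
    using has_derivative_bounded_linear[OF assms(1)] bounded_linear_scaleR_const by blast
  ultimately show ?thesis
    by (simp add: has_derivative_at_within)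
qed

text \<open>
  Pointwise convergence of linear maps in finite dimension is uniform on the unit ball, so a
  lower bound for the injective limit survives nearby with a smaller constant. For invertible maps
  this bounds the inverses locally.
\<close>

lemma eventually_linear_bounded_below:
  fixes A :: "'a::t2_space \<Rightarrow> 'b::euclidean_space \<Rightarrow> 'c::euclidean_space"
  assumes lin: "\<forall>\<^sub>F z in at y. linear (A z)" "linear (A y)" and "inj (A y)"
    and cont: "\<And>v. isCont (\<lambda>z. A z v) y"
  obtains m where "m > 0" "\<forall>\<^sub>F z in at y. \<forall>v. m * norm v \<le> norm (A z v)"
proof -
  obtain m where m: "m > 0" "\<And>v. m * norm v \<le> norm (A y v)"
    using linear_inj_bounded_below_pos[OF lin(2) \<open>inj (A y)\<close>] by blast
  have "((\<lambda>z. \<Sum>i\<in>Basis. norm (A z i - A y i)) \<longlongrightarrow> (\<Sum>i\<in>Basis. norm (A y i - A y i))) (at y)"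
    using cont by (intro tendsto_intros) (simp add: isCont_def)
  then have "\<forall>\<^sub>F z in at y. (\<Sum>i\<in>Basis. norm (A z i - A y i)) < m / 2"
    using m(1) by (intro order_tendstoD(2)) auto
  then have "\<forall>\<^sub>F z in at y. \<forall>v. m / 2 * norm v \<le> norm (A z v)"
    using lin(1)
  proof eventually_elim
    case (elim z)
    show ?case
    proof
      fix v
      have "A z v - A y v = (\<Sum>i\<in>Basis. (v \<bullet> i) *\<^sub>R (A z i - A y i))"
        using linear_eq_sum_Basis[OF lin(2), of v] linear_eq_sum_Basis[OF elim(2), of v]
        by (simp add: sum_subtractf scaleR_diff_right)
      also have "norm \<dots> \<le> (\<Sum>i\<in>Basis. norm v * norm (A z i - A y i))"
        by (rule sum_norm_le) (auto intro!: mult_right_mono Basis_le_norm)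
      also have "\<dots> \<le> m / 2 * norm v"
        using mult_right_mono[OF less_imp_le[OF elim(1)] norm_ge_zero[of v]]
        by (simp add: sum_distrib_left mult.commute)
      finally show "m / 2 * norm v \<le> norm (A z v)"
        using m(2)[of v] norm_triangle_ineq2[of "A y v" "A z v"]
        by (simp add: norm_minus_commute)
    qed
  qed
  then show ?thesis
    using that[of "m / 2"] m(1) by simp
qed

text \<open>
  Inversion of linear maps preserves C^k. The derivative of \<open>W y v\<close> in the direction \<open>a\<close> is
  \<open>- W y (D_a A y (W y v))\<close>; expanded in a basis, it is a sum of products of values of \<open>W\<close> and
  derivatives of \<open>A\<close> in constant directions, so the claim for \<open>k\<close> gives the claim for \<open>k + 1\<close>.
\<close>

lemma times_cont_diff_on_linear_inverse:
  fixes A W :: "'a::euclidean_space \<Rightarrow> 'b::euclidean_space \<Rightarrow> 'b"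
  assumes "open V"
    and lin: "\<And>y. y \<in> V \<Longrightarrow> linear (A y)" "\<And>y. y \<in> V \<Longrightarrow> linear (W y)"
    and AW: "\<And>y v. y \<in> V \<Longrightarrow> A y (W y v) = v" and WA: "\<And>y v. y \<in> V \<Longrightarrow> W y (A y v) = v"
    and "\<And>v. times_cont_diff_on k (\<lambda>y. A y v) V"
  shows "times_cont_diff_on k (\<lambda>y. W y v) V"
  using assms(6)
proof (induction k arbitrary: v)
  case 0
  have "isCont (\<lambda>z. W z v) y" if y: "y \<in> V" for y
  proof -
    have inV: "\<forall>\<^sub>F z in at y. z \<in> V"
      using \<open>open V\<close> y by (rule eventually_at_in_open')
    have cont: "isCont (\<lambda>z. A z v) y" for v
      using 0[of v] \<open>open V\<close> y by (simp add: continuous_on_eq_continuous_at)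
    obtain m where m: "m > 0" "\<forall>\<^sub>F z in at y. \<forall>v. m * norm v \<le> norm (A z v)"
    proof (rule eventually_linear_bounded_below[OF _ lin(1)[OF y] _ cont])
      show "\<forall>\<^sub>F z in at y. linear (A z)"
        using inV by (rule eventually_mono) (rule lin(1))
      show "inj (A y)"
        using WA[OF y] by (metis injI)
    qed
    \<comment> \<open>As \<open>A z (W z v - c) = v - A z c\<close>, the lower bound for \<open>A z\<close> controls the increment of \<open>W\<close>.\<close>
    define c where "c = W y v"
    have "((\<lambda>z. W z v - c) \<longlongrightarrow> 0) (at y)"
    proof (rule Lim_null_comparison)
      show "\<forall>\<^sub>F z in at y. norm (W z v - c) \<le> norm (v - A z c) / m"
        using m(2) inV
      proof eventually_elim
        case (elim z)
        have "A z (W z v - c) = v - A z c"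
          using AW lin(1) elim by (simp add: linear_diff)
        then show ?case
          using elim(1) m(1) by (metis mult.commute pos_le_divide_eq)
      qed
      have "((\<lambda>z. norm (v - A z c) / m) \<longlongrightarrow> norm (v - A y c) / m) (at y)"
        using cont m(1) by (intro tendsto_intros) (auto simp: isCont_def)
      then show "((\<lambda>z. norm (v - A z c) / m) \<longlongrightarrow> 0) (at y)"
        using AW[OF y] by (simp add: c_def)
    qed
    then show ?thesis
      by (simp add: isCont_def c_def LIM_zero_iff)
  qed
  then show ?case
    using \<open>open V\<close> by (simp add: continuous_on_eq_continuous_at)
next
  case (Suc k)
  define A' where "A' y a j = frechet_derivative (\<lambda>y. A y j) (at y) a" for y a j
  have dA: "((\<lambda>y. A y j) has_derivative (\<lambda>a. A' y a j)) (at y)" if "y \<in> V" for y j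
    using times_cont_diff_on_SucD(1)[OF Suc.prems that] by (simp add: A'_def)
  have A': "times_cont_diff_on k (\<lambda>y. A' y a j) V" for a j
    using times_cont_diff_on_SucD(2)[OF Suc.prems] by (simp add: A'_def)
  have W: "times_cont_diff_on k (\<lambda>y. W y v) V" for v
    using Suc.IH Suc.prems times_cont_diff_on_Suc_imp by blast
  have contW: "isCont (\<lambda>z. W z v) y" if "y \<in> V" for y v
  proof -
    show ?thesis
      using times_cont_diff_on_imp_continuous_on[OF W] \<open>open V\<close> that continuous_on_eq_continuous_at
      by blast
  qed
  show ?case
  proof (rule times_cont_diff_on_SucI[OF \<open>open V\<close>])
    show "((\<lambda>y. W y v) has_derivative
        (\<lambda>a. - (\<Sum>l\<in>Basis. (\<Sum>j\<in>Basis. (W y v \<bullet> j) *\<^sub>R (A' y a j \<bullet> l)) *\<^sub>R W y l))) (at y)"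
      if y: "y \<in> V" for y
    proof (rule has_derivative_transform_within_open[OF _ \<open>open V\<close> y])
      \<comment> \<open>With \<open>y\<close> held constant, \<open>W z v = W y v - W z (r z)\<close> where \<open>r z = A z (W y v) - v\<close>
        vanishes at \<open>y\<close>, so that continuity of \<open>W\<close> is enough to differentiate \<open>W z (r z)\<close>.\<close>
      define r where "r z = (\<Sum>j\<in>Basis. (W y v \<bullet> j) *\<^sub>R A z j) - v" for z
      have r: "r z = A z (W y v) - v" if "z \<in> V" for z
        using linear_eq_sum_Basis[OF lin(1)[OF that], of "W y v"] by (simp add: r_def)
      show "W y v - (\<Sum>l\<in>Basis. (r z \<bullet> l) *\<^sub>R W z l) = W z v" if "z \<in> V" for z
      proof -
        have "(\<Sum>l\<in>Basis. (r z \<bullet> l) *\<^sub>R W z l) = W z (r z)"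
          by (rule linear_eq_sum_Basis[OF lin(2)[OF that], symmetric])
        then show ?thesis
          using that by (simp add: r linear_diff[OF lin(2)] WA)
      qed
      have "((\<lambda>z. \<Sum>l\<in>Basis. (r z \<bullet> l) *\<^sub>R W z l) has_derivative
          (\<lambda>a. \<Sum>l\<in>Basis. (\<Sum>j\<in>Basis. (W y v \<bullet> j) *\<^sub>R (A' y a j \<bullet> l)) *\<^sub>R W y l)) (at y)"
      proof (rule has_derivative_sum, rule has_derivative_scaleR_vanishing)
        fix l
        show "((\<lambda>z. r z \<bullet> l) has_derivative
            (\<lambda>a. \<Sum>j\<in>Basis. (W y v \<bullet> j) *\<^sub>R (A' y a j \<bullet> l))) (at y)"
          unfolding r_def
          by (auto intro!: derivative_eq_intros dA y simp: inner_sum_left)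
        show "r y \<bullet> l = 0"
          using r[OF y] AW[OF y] by simp
      qed (use contW y in auto)
      from has_derivative_diff[OF has_derivative_const this]
      show "((\<lambda>z. W y v - (\<Sum>l\<in>Basis. (r z \<bullet> l) *\<^sub>R W z l)) has_derivative
          (\<lambda>a. - (\<Sum>l\<in>Basis. (\<Sum>j\<in>Basis. (W y v \<bullet> j) *\<^sub>R (A' y a j \<bullet> l)) *\<^sub>R W y l))) (at y)"
        by simp
    qed
    show "times_cont_diff_on k
        (\<lambda>y. - (\<Sum>l\<in>Basis. (\<Sum>j\<in>Basis. (W y v \<bullet> j) *\<^sub>R (A' y a j \<bullet> l)) *\<^sub>R W y l)) V" for a
      by (intro times_cont_diff_on_linear_compose[OF _ bounded_linear_minus[OF bounded_linear_ident]]
          times_cont_diff_on_sum times_cont_diff_on_bilinear[OF _ bounded_bilinear_scaleR]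
          times_cont_diff_on_inner_left \<open>open V\<close> finite_Basis W A')
  qed
qed

text \<open>
  The derivative of \<open>g\<close> at \<open>y\<close> inverts \<open>D f_(g y)\<close>, an expression in \<open>g\<close> itself and not in its
  derivatives, so every order of differentiability known for \<open>g\<close> passes to its derivative.
\<close>

lemma smooth_on_inverse:
  fixes f g :: "'a::euclidean_space \<Rightarrow> 'a"
  assumes "open V" "g ` V \<subseteq> U" "smooth_on f U"
    and dg: "\<And>y. y \<in> V \<Longrightarrow> (g has_derivative g' y) (at y)"
    and fg: "\<And>y v. y \<in> V \<Longrightarrow> frechet_derivative f (at (g y)) (g' y v) = v"
    and gf: "\<And>y v. y \<in> V \<Longrightarrow> g' y (frechet_derivative f (at (g y)) v) = v"
  shows "smooth_on g V"
proof -
  have f: "times_cont_diff_on (Suc k) f U" for k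
    using assms(3) by (simp only: smooth_on_def)
  have "times_cont_diff_on k g V" for k
  proof (induction k)
    case 0
    then show ?case
      using dg by (auto intro!: continuous_at_imp_continuous_on has_derivative_continuous)
  next
    case (Suc k)
    have "times_cont_diff_on k (\<lambda>y. g' y v) V" for v
    proof (rule times_cont_diff_on_linear_inverse[OF \<open>open V\<close> _ _ fg gf])
      show "linear (frechet_derivative f (at (g y)))" if "y \<in> V" for y
        using times_cont_diff_on_SucD(1)[OF f] assms(2) that has_derivative_linear by blast
      show "linear (g' y)" if "y \<in> V" for y
        using dg[OF that] has_derivative_linear by blast
      show "times_cont_diff_on k (\<lambda>y. frechet_derivative f (at (g y)) v) V" for v
        by (rule times_cont_diff_on_compose[OF \<open>open V\<close> assms(2)
              times_cont_diff_on_SucD(2)[OF f] Suc.IH])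
    qed
    then show ?case
      using times_cont_diff_on_SucI[OF \<open>open V\<close> dg] by blast
  qed
  then show ?thesis
    by (simp add: smooth_on_def)
qed

text \<open>
  The inverse function theorem with a smooth inverse. A general invertible derivative reduces to the
  identity by composing with a linear map.
\<close>

lemma smooth_local_diffeomorphism:
  fixes f :: "'a::euclidean_space \<Rightarrow> 'a"
  assumes "smooth_on f UNIV" "frechet_derivative f (at x) = id"
  obtains U V g where "x \<in> U" "diffeomorphism U V f g"
proof -
  have f: "times_cont_diff_on (Suc k) f UNIV" for k
    using assms(1) by (simp only: smooth_on_def)
  have df: "(f has_derivative frechet_derivative f (at y)) (at y)" for y
    using times_cont_diff_on_SucD(1)[OF f] by blast
  define f' where "f' y = Blinfun (frechet_derivative f (at y))" for y
  have f': "blinfun_apply (f' y) = frechet_derivative f (at y)" for y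
    unfolding f'_def by (rule bounded_linear_Blinfun_apply[OF has_derivative_bounded_linear[OF df]])
  have cont: "continuous_on UNIV f'"
    using times_cont_diff_on_SucD(2)[OF f[of 0]]
    by (intro continuous_on_blinfun_componentwise) (simp add: f')
  have id: "id_blinfun o\<^sub>L f' x = id_blinfun"
    by (rule blinfun_eqI) (simp add: f' assms(2))
  obtain U V g g' where U: "open U" "x \<in> U" "open V" and hom: "homeomorphism U V f g"
    and dg: "\<And>y. y \<in> V \<Longrightarrow> (g has_derivative (g' y)) (at y)"
    and g': "\<And>y. y \<in> V \<Longrightarrow> g' y = inv (frechet_derivative f (at (g y)))"
    and bij: "\<And>y. y \<in> V \<Longrightarrow> bij (frechet_derivative f (at (g y)))"
    using inverse_function_theorem[of UNIV f f' x id_blinfun, unfolded f', OF _ df cont _ id]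
    by (metis UNIV_I open_UNIV)
  have fU: "smooth_on f U"
    unfolding smooth_on_def
    by (rule allI, rule times_cont_diff_on_subset[OF _ subset_UNIV])
      (use assms(1) in \<open>simp add: smooth_on_def\<close>)
  have "smooth_on g V"
  proof (rule smooth_on_inverse[OF \<open>open V\<close> _ fU dg])
    show "g ` V \<subseteq> U"
      using hom by (simp add: homeomorphism_def)
  qed (use g' bij in \<open>auto simp: bij_is_surj surj_f_inv_f bij_is_inj\<close>)
  then have "diffeomorphism U V f g"
    using U hom fU by (simp add: diffeomorphism_def)
  with U(2) show ?thesis
    by (rule that)
qed

section \<open>Regular level sets\<close>

text \<open>
  The domain is the direct sum of the kernel and the range of a linear right inverse of \<open>D\<close>.
\<close>

lemma dim_kernel_surjective:
  fixes D :: "'a::euclidean_space \<Rightarrow> 'b::euclidean_space"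
  assumes "linear D" "surj D"
  shows "dim {v. D v = 0} + DIM('b) = DIM('a)"
proof -
  obtain R where R: "linear R" "D \<circ> R = id"
    using linear_surjective_right_inverse[OF assms] by blast
  have DR: "D (R w) = w" for w
    using fun_cong[OF R(2)] by simp
  have K: "subspace {v. D v = 0}"
    using assms(1) by (rule linear_subspace_kernel)
  have rR: "subspace (range R)"
    using R(1) by (simp add: linear_subspace_image)
  have "{a + b |a b. a \<in> {v. D v = 0} \<and> b \<in> range R} = UNIV" (is "?sums = UNIV")
  proof (rule UNIV_eq_I[symmetric])
    fix v
    have "v = (v - R (D v)) + R (D v)" "D (v - R (D v)) = 0"
      by (simp_all add: linear_diff[OF assms(1)] DR)
    then show "v \<in> ?sums"
      by blast
  qed
  moreover have "{v. D v = 0} \<inter> range R = {0}"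
  proof -
    have "R w = 0" if "D (R w) = 0" for w
      using that linear_0[OF R(1)] by (simp add: DR)
    moreover have "0 \<in> range R"
      using linear_0[OF R(1)] by (metis rangeI)
    ultimately show ?thesis
      using linear_0[OF assms(1)] by blast
  qed
  moreover have "inj R"
    using DR by (rule inj_on_inverseI)
  then have "dim (range R) = DIM('b)"
    using dim_image_eq[OF R(1), of UNIV] by simp
  ultimately show ?thesis
    using dim_sums_Int[OF K rR] by simp
qed

text \<open>
  The map \<open>y \<mapsto> P y + R (h y)\<close> replaces the component of \<open>y\<close> transversal to the kernel
  of the derivative by the value of \<open>h\<close>, read off again by \<open>D\<close>. Since
  \<open>h\<close> agrees with \<open>D\<close> to first order at \<open>x\<close>, this does not change the derivative there.
\<close>

lemma embedded_submanifold_regular_level_set: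
  fixes h :: "'a::euclidean_space \<Rightarrow> 'b::euclidean_space"
  assumes "smooth_on h UNIV"
    and "\<And>x. h x = 0 \<Longrightarrow> surj (frechet_derivative h (at x))"
    and "d + DIM('b) = DIM('a)"
  shows "embedded_submanifold d {x. h x = 0}"
  unfolding embedded_submanifold_def
proof
  fix x
  assume "x \<in> {x. h x = 0}"
  define D where "D = frechet_derivative h (at x)"
  have h: "times_cont_diff_on k h UNIV" for k
    using assms(1) by (simp only: smooth_on_def)
  have dh: "(h has_derivative frechet_derivative h (at y)) (at y)" for y
    using times_cont_diff_on_SucD(1)[OF h] by blast
  have D: "linear D" "surj D"
    using has_derivative_linear[OF dh] assms(2) \<open>x \<in> {x. h x = 0}\<close> by (auto simp: D_def)
  obtain R where R: "linear R" "D \<circ> R = id"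
    using linear_surjective_right_inverse[OF D] by blast
  have DR: "D (R w) = w" for w
    using fun_cong[OF R(2)] by simp
  define P where "P v = v - R (D v)" for v
  have P: "linear P"
    using linear_compose_sub[OF linear_id linear_compose[OF D(1) R(1)]]
    by (simp add: P_def[abs_def] o_def)
  define \<phi> where "\<phi> y = P y + R (h y)" for y
  have "smooth_on \<phi> UNIV"
    unfolding smooth_on_def \<phi>_def
    using times_cont_diff_on_add[OF open_UNIV
        times_cont_diff_on_linear[OF open_UNIV P[unfolded linear_conv_bounded_linear]]
        times_cont_diff_on_linear_compose[OF open_UNIV R(1)[unfolded linear_conv_bounded_linear] h]]
    by (rule allI)
  moreover have "frechet_derivative \<phi> (at x) = id"
  proof -
    have "(\<phi> has_derivative (\<lambda>v. P v + R (D v))) (at x)"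
      unfolding \<phi>_def D_def using P R(1) dh
      by (intro has_derivative_add bounded_linear_imp_has_derivative
          bounded_linear.has_derivative[of R]) (auto simp: linear_conv_bounded_linear)
    then have "(\<phi> has_derivative id) (at x)"
      by (simp add: P_def id_def)
    then show ?thesis
      by (rule frechet_derivative_at[symmetric])
  qed
  ultimately obtain U V \<psi> where U: "x \<in> U" "diffeomorphism U V \<phi> \<psi>"
    by (rule smooth_local_diffeomorphism)
  have "D (\<phi> y) = h y" for y
    by (simp add: \<phi>_def P_def linear_add[OF D(1)] linear_diff[OF D(1)] DR)
  moreover have "\<phi> ` U = V"
    using U(2) by (simp add: diffeomorphism_def homeomorphism_def)
  ultimately have "\<phi> ` ({x. h x = 0} \<inter> U) = {v. D v = 0} \<inter> V"
    by auto
  moreover have "subspace {v. D v = 0}"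
    using D(1) by (rule linear_subspace_kernel)
  moreover have "dim {v. D v = 0} = d"
    using dim_kernel_surjective[OF D] assms(3) by simp
  ultimately show "\<exists>U V \<phi> \<psi>. \<exists>L::'a set. x \<in> U \<and> diffeomorphism U V \<phi> \<psi> \<and> subspace L \<and>
      dim L = d \<and> \<phi> ` ({x. h x = 0} \<inter> U) = L \<inter> V"
    using U by (intro exI[of _ U] exI[of _ V] exI[of _ \<phi>] exI[of _ \<psi>]
        exI[of _ "{v. D v = 0}"] conjI)
qed

section \<open>Appending zero columns\<close>

lemma bij_betw_col_pos:
  "bij_betw (col_pos :: 'n::{finite,linorder} \<Rightarrow> nat) UNIV {..<CARD('n)}"
proof -
  have "strict_mono (col_pos :: 'n \<Rightarrow> nat)"
    unfolding col_pos_def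
    by (intro strict_monoI psubset_card_mono) (auto intro: less_trans)
  then have inj: "inj (col_pos :: 'n \<Rightarrow> nat)"
    by (rule strict_mono_imp_inj_on)
  have "col_pos j < CARD('n)" for j :: 'n
    unfolding col_pos_def by (intro psubset_card_mono) auto
  then have "range (col_pos :: 'n \<Rightarrow> nat) = {..<CARD('n)}"
    by (intro card_subset_eq) (auto simp: card_image inj)
  then show ?thesis
    using inj by (simp add: bij_betw_def)
qed

lemma the_col_pos: "(THE k. col_pos k = col_pos j) = j" for j :: "'n::{finite,linorder}"
proof (rule the_equality)
  fix k :: 'n
  assume "col_pos k = col_pos j"
  then show "k = j"
    by (rule injD[OF bij_betw_imp_inj_on[OF bij_betw_col_pos]])
qed simp

lemma linear_append_zero_cols: "linear append_zero_cols"
  by (rule linearI) (auto simp: append_zero_cols_def vec_eq_iff)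

lemma range_append_zero_cols:
  fixes E :: "real^'n::{finite,linorder}^'m::finite"
  assumes "CARD('s::{finite,linorder}) \<le> CARD('n)"
    and "\<And>i j. CARD('s::{finite,linorder}) \<le> col_pos j \<Longrightarrow> E $ i $ j = 0"
  obtains H :: "real^'s::{finite,linorder}^'m" where "append_zero_cols H = E"
proof
  let ?H = "(\<chi> i k. E $ i $ (THE j. col_pos j = col_pos k)) :: real^'s::{finite,linorder}^'m"
  have inj_n: "(THE j'. col_pos j' = col_pos j) = j" for j :: 'n
    by (rule the_col_pos)
  have "col_pos (THE k::'s. col_pos k = col_pos j) = col_pos j"
    if less: "col_pos j < CARD('s)" for j :: 'n
  proof -
    have "col_pos j \<in> range (col_pos :: 's \<Rightarrow> nat)"
      using bij_betw_col_pos[where 'n = 's] less by (simp add: bij_betw_def)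
    then obtain k :: 's where k: "col_pos k = col_pos j"
      by (metis imageE)
    have "(THE k'. col_pos k' = col_pos k) = k"
      by (rule the_col_pos)
    then show ?thesis
      using k by simp
  qed
  then show "append_zero_cols ?H = E"
    using assms(2) by (auto simp: append_zero_cols_def vec_eq_iff inj_n not_less)
qed

definition negate_cols_from :: "nat \<Rightarrow> real^'n::{finite,linorder}^'n::{finite,linorder}" where
  "negate_cols_from s = (\<chi> i j. if i = j then (if col_pos i < s then 1 else -1) else 0)"

lemma matrix_mult_negate_cols_from:
  "(X ** negate_cols_from s) $ i $ j = (if col_pos j < s then 1 else -1) * X $ i $ j"
  by (simp add: matrix_matrix_mult_def negate_cols_from_def if_distrib cong: if_cong)

lemma orthogonal_negate_cols_from: "orthogonal_matrix (negate_cols_from s)"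
proof -
  have transpose: "transpose (negate_cols_from s) =
      (negate_cols_from s :: real^'n::{finite,linorder}^'n::{finite,linorder})"
    by (simp add: transpose_def negate_cols_from_def vec_eq_iff)
  show ?thesis
    unfolding orthogonal_matrix transpose
    by (simp add: vec_eq_iff matrix_mult_negate_cols_from)
      (simp add: negate_cols_from_def mat_def)
qed

text \<open>
  With \<open>Q = negate_cols_from s\<close>, \<open>E\<close> and \<open>E Q\<close> have the same image under the derivative, hence so does their mean, in
  which the last columns cancel. The mean is therefore a preimage of \<open>D E\<close> of the form \<open>[K 0]\<close>.
\<close>

lemma range_derivative_restrict_cols:
  fixes h :: "real^'n::{finite,linorder}^'m::finite \<Rightarrow> 'b::real_normed_vector"
    and H :: "real^'s::{finite,linorder}^'m"
  assumes "orthogonally_invariant h" "CARD('s) \<le> CARD('n)"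
    and dh: "(h has_derivative D) (at (append_zero_cols H))"
  shows "range (\<lambda>K :: real^'s::{finite,linorder}^'m. D (append_zero_cols K)) = range D"
proof -
  let ?X = "append_zero_cols H"
  let ?Q = "negate_cols_from CARD('s) :: real^'n::{finite,linorder}^'n::{finite,linorder}"
  have XQ: "?X ** ?Q = ?X"
    by (auto simp: vec_eq_iff matrix_mult_negate_cols_from append_zero_cols_def)
  have lin: "linear D"
    using dh by (rule has_derivative_linear)
  have "linear (\<lambda>X::real^'n::{finite,linorder}^'m. X ** ?Q)"
    by (rule linearI) (simp_all add: vec_eq_iff matrix_mult_negate_cols_from)
  then have "((\<lambda>X::real^'n::{finite,linorder}^'m. X ** ?Q) has_derivative (\<lambda>E. E ** ?Q)) (at ?X)"
    by (intro bounded_linear_imp_has_derivative) (simp add: linear_conv_bounded_linear)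
  then have "((\<lambda>X. h (X ** ?Q)) has_derivative (\<lambda>E. D (E ** ?Q))) (at ?X)"
    by (rule has_derivative_compose) (simp add: XQ dh)
  moreover have "h (X ** ?Q) = h X" for X
    using assms(1) orthogonal_negate_cols_from unfolding orthogonally_invariant_def by blast
  ultimately have "(h has_derivative (\<lambda>E. D (E ** ?Q))) (at ?X)"
    by (simp only:)
  then have "(\<lambda>E. D (E ** ?Q)) = D"
    using dh by (rule has_derivative_unique)
  then have inv: "D (E ** ?Q) = D E" for E
    by (rule fun_cong)
  have "D E \<in> range (\<lambda>K :: real^'s::{finite,linorder}^'m. D (append_zero_cols K))" for E
  proof -
    obtain K :: "real^'s::{finite,linorder}^'m" where K: "append_zero_cols K = (1/2) *\<^sub>R (E + E ** ?Q)"
      by (rule range_append_zero_cols[OF assms(2), of "(1/2) *\<^sub>R (E + E ** ?Q)"])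
        (simp_all add: matrix_mult_negate_cols_from)
    have "D (append_zero_cols K) = (1/2) *\<^sub>R (D E + D E)"
      by (simp only: K linear_scale[OF lin] linear_add[OF lin] inv)
    also have "\<dots> = D E"
      by (rule scaleR_half_double)
    finally show ?thesis
      by (rule range_eqI[OF sym])
  qed
  then show ?thesis
    by blast
qed

theorem proposition2:
  fixes h :: "real^'n::{finite,linorder}^'m::finite \<Rightarrow> real^'q::finite"
    and hs :: "real^'s::{finite,linorder}^'m \<Rightarrow> real^'q"
  assumes "smooth_on h UNIV"
    and "orthogonally_invariant h"
    and "\<And>X. h X = 0 \<Longrightarrow> dim (range (frechet_derivative h (at X))) = CARD('q)"
    and "CARD('s) \<le> CARD('n)"
    and "hs = restrict_cols h"
    and "{H. hs H = 0} \<noteq> {}"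
  shows "\<exists>d. int d = int (CARD('m) * CARD('s)) - int CARD('q) \<and>
             embedded_submanifold d {H. hs H = 0}"
proof -
  let ?L = "append_zero_cols :: real^'s::{finite,linorder}^'m \<Rightarrow> real^'n::{finite,linorder}^'m"
  have L: "bounded_linear ?L"
    using linear_append_zero_cols linear_conv_bounded_linear by blast
  have hs: "hs = (\<lambda>H. h (?L H))"
    using assms(5) by (simp add: restrict_cols_def fun_eq_iff)
  have h: "times_cont_diff_on k h UNIV" for k
    using assms(1) by (simp only: smooth_on_def)
  have smooth: "smooth_on hs UNIV"
    unfolding smooth_on_def hs
    by (intro allI times_cont_diff_on_compose[OF open_UNIV subset_UNIV h]
        times_cont_diff_on_linear[OF open_UNIV L])
  have dh: "(h has_derivative frechet_derivative h (at X)) (at X)" for X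
    using times_cont_diff_on_SucD(1)[OF h] by blast
  have dhs: "(hs has_derivative (\<lambda>K. frechet_derivative h (at (?L H)) (?L K))) (at H)" for H
    unfolding hs
    using has_derivative_compose[OF bounded_linear_imp_has_derivative[OF L] dh] .
  have surj: "surj (frechet_derivative hs (at H))" if "hs H = 0" for H
  proof -
    let ?D = "frechet_derivative h (at (?L H))"
    have "range (frechet_derivative hs (at H)) = range (\<lambda>K. ?D (?L K))"
      by (simp only: frechet_derivative_at[OF dhs, symmetric])
    also have "\<dots> = range ?D"
      by (rule range_derivative_restrict_cols[OF assms(2,4) dh])
    also have "\<dots> = span (range ?D)"
      using linear_subspace_image[OF has_derivative_linear[OF dh] subspace_UNIV]
      by (rule span_eq_iff[THEN iffD2, symmetric])
    also have "\<dots> = UNIV"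
      by (rule dim_eq_full[THEN iffD1]) (use assms(3)[of "?L H"] that in \<open>simp add: hs\<close>)
    finally show ?thesis .
  qed
  obtain H where H: "hs H = 0"
    using assms(6) by blast
  have "linear (frechet_derivative hs (at H))"
    unfolding frechet_derivative_at[OF dhs, symmetric] by (rule has_derivative_linear[OF dhs])
  note dim_kernel = dim_kernel_surjective[OF this surj[OF H]]
  define d where "d = dim {v. frechet_derivative hs (at H) v = 0}"
  have d: "d + CARD('q) = CARD('m) * CARD('s)"
    using dim_kernel by (simp add: d_def)
  have "embedded_submanifold d {H. hs H = 0}"
    by (rule embedded_submanifold_regular_level_set[OF smooth surj]) (simp_all add: d)
  moreover have "int d = int (CARD('m) * CARD('s)) - int CARD('q)"
    using d by linarith
  ultimately show ?thesis
    by blast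
qed

end
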